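(* Let $(W,S)$ be a finite Coxeter system, $Q=q_1\cdots q_m$ a word on $S$, and $\rho\in W$. Let $I\ne\mathsf N(Q,\rho)$ be a facet of $\mathcal{SC}(Q,\rho)$. Define $y$ to be the smallest position in $[m]$ such that $$I\cap[y]\ne\mathsf N\big(q_1\cdots q_y,\ \Pi Q_{[y]\setminus I}\big),$$ and $x$ to be the smallest position in $I$ such that $\mathsf r(I,x)=\mathsf r(I,y)$. Then the father of $I$ in the negative sink tree $\mathcal N^*(Q,\rho)$ is obtained from $I$ by flipping $x$.
   Context: Let $(W,S)$ be a finite Coxeter system acting by reflections on a Euclidean space $V$, with length function $\ell$, root system $\Phi=\Phi^+\sqcup\Phi^-$ and simple roots $\{\alpha_s: s\in S\}$. For a word $Q=q_1q_2\cdots q_m$ in the letters $S$ and $\rho\in W$, write $[m]=\{1,\dots,m\}$, and for $X\subseteq[m]$ let $\Pi Q_X\in W$ be the product of the reflections $q_x$, $x\in X$, in increasing order of position. The subword complex $\mathcal{SC}(Q,\rho)$ is the simplicial complex whose facets are the sets $I\subseteq[m]$ such that the letters of $Q$ at the positions in $[m]\setminus I$, read in increasing order of position, form a reduced expression of $\rho$. The root function of a facet $I$ is $\mathsf r(I,k)=\Pi Q_{[k-1]\setminus I}(\alpha_{q_k})\in\Phi$ for $k\in[m]$. Two distinct facets $I,J$ are adjacent if $I\setminus\{i\}=J\setminus\{j\}$ for some $i\in I$, $j\in J$; then $J$ is obtained from $I$ by flipping $i$ (given $I$ and $i$, the facet $J\ne I$ is unique if it exists). The flip is increasing if $i<j$.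 The increasing flip graph $\mathcal G(Q,\rho)$ is the directed graph whose vertices are the facets and whose edges $I\to J$ are the increasing flips. For an edge $I\to J$ with $I\setminus\{i\}=J\setminus\{j\}$, $i<j$, set $\mathsf n(I\to J)=j$. A path is $\mathsf n$-rising if the sequence of $\mathsf n$-labels of its successive edges is strictly increasing. When $\mathcal{SC}(Q,\rho)$ is non-empty, the negative greedy facet $\mathsf N(Q,\rho)$ is the unique sink of $\mathcal G(Q,\rho)$ (equivalently the lexicographically largest facet). The negative sink tree $\mathcal N^*(Q,\rho)$ is the spanning tree of $\mathcal G(Q,\rho)$, rooted at $\mathsf N(Q,\rho)$, formed by all $\mathsf n$-rising paths from the facets to $\mathsf N(Q,\rho)$ (there is exactly one from each facet); the father of $I\ne\mathsf N(Q,\rho)$ is the facet following $I$ on the $\mathsf n$-rising path from $I$ to $\mathsf N(Q,\rho)$. *)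

theory Defs
  imports
    "HOL-Analysis.Analysis"
    "HOL-Algebra.Multiplicative_Group"
    "HOL-Algebra.Group_Action"
begin

section \<open>Finite Coxeter systems acting by reflections\<close>

text \<open>The letters of a word are the elements of \<open>S\<close> themselves, so a word on \<open>S\<close> is a list
  over the carrier of \<open>W\<close>.\<close>

definition word_prod :: "('w, 'm) monoid_scheme \<Rightarrow> 'w list \<Rightarrow> 'w" where
  "word_prod W ws = foldr (\<otimes>\<^bsub>W\<^esub>) ws \<one>\<^bsub>W\<^esub>"

text \<open>Deletion of one Coxeter relator \<open>(s t)\<^bsup>m(s,t)\<^esup>\<close>, where \<open>m(s,t)\<close> is the order of \<open>s t\<close>.
  For \<open>s = t\<close> the relator is \<open>s s\<close>; if \<open>s t\<close> has infinite order, \<open>group.ord\<close> is \<open>0\<close> and the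
  relator is the empty word.\<close>

inductive coxeter_step :: "('w, 'm) monoid_scheme \<Rightarrow> 'w set \<Rightarrow> 'w list \<Rightarrow> 'w list \<Rightarrow> bool"
  for W S where
  "s \<in> S \<Longrightarrow> t \<in> S \<Longrightarrow>
    coxeter_step W S (us @ concat (replicate (group.ord W (s \<otimes>\<^bsub>W\<^esub> t)) [s, t]) @ vs) (us @ vs)"

text \<open>\<open>presentation\<close> says that \<open>W\<close> is presented by the generators \<open>S\<close> and the Coxeter relators.
  Since every generator is an involution, the free monoid on \<open>S\<close> can be used in place of the free
  group.\<close>

locale coxeter_system = group W
  for W :: "('w, 'm) monoid_scheme" (structure) +
  fixes S :: "'w set"
  assumes generators_closed: "S \<subseteq> carrier W"
    and generators_involutive: "s \<in> S \<Longrightarrow> ord s = 2"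
    and generates: "generate W S = carrier W"
    and presentation: "us \<in> lists S \<Longrightarrow> vs \<in> lists S \<Longrightarrow> word_prod W us = word_prod W vs \<Longrightarrow>
          equivclp (coxeter_step W S) us vs"

definition reflection :: "'v::euclidean_space \<Rightarrow> 'v \<Rightarrow> 'v" where
  "reflection a x = x - (2 * (x \<bullet> a) / (a \<bullet> a)) *\<^sub>R a"

definition roots ::
  "('w, 'm) monoid_scheme \<Rightarrow> 'w set \<Rightarrow> ('w \<Rightarrow> 'v \<Rightarrow> 'v) \<Rightarrow> ('w \<Rightarrow> 'v) \<Rightarrow> 'v set" where
  "roots W S act \<alpha> = {act w (\<alpha> s) | w s. w \<in> carrier W \<and> s \<in> S}"

definition positive_roots ::
  "('w, 'm) monoid_scheme \<Rightarrow> 'w set \<Rightarrow> ('w \<Rightarrow> 'v \<Rightarrow> 'v::euclidean_space) \<Rightarrow> ('w \<Rightarrow> 'v) \<Rightarrow> 'v set"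
  where
  "positive_roots W S act \<alpha> = {\<beta> \<in> roots W S act \<alpha>.
     \<exists>c. (\<forall>s\<in>S. 0 \<le> c s) \<and> \<beta> = (\<Sum>s\<in>S. c s *\<^sub>R \<alpha> s)}"

definition negative_roots ::
  "('w, 'm) monoid_scheme \<Rightarrow> 'w set \<Rightarrow> ('w \<Rightarrow> 'v \<Rightarrow> 'v::euclidean_space) \<Rightarrow> ('w \<Rightarrow> 'v) \<Rightarrow> 'v set"
  where
  "negative_roots W S act \<alpha> = uminus ` positive_roots W S act \<alpha>"

text \<open>A finite Coxeter system realised as a reflection group on a Euclidean space, with a (reduced)
  root system in which \<open>\<alpha> s\<close>, \<open>s \<in> S\<close>, are the simple roots. Positive and negative roots are
  disjoint by linear independence of the simple roots. The action need not be essential: the simple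
  roots need not span the space.\<close>

locale finite_coxeter_realization =
  coxeter_system W S + faithful_action W "UNIV :: 'v set" act
  for W :: "('w, 'm) monoid_scheme" (structure) and S :: "'w set"
    and act :: "'w \<Rightarrow> 'v \<Rightarrow> 'v::euclidean_space" +
  fixes \<alpha> :: "'w \<Rightarrow> 'v"
  assumes finite_carrier: "finite (carrier W)"
    and generator_acts: "s \<in> S \<Longrightarrow> act s = reflection (\<alpha> s)"
    and simple_roots_inj: "inj_on \<alpha> S"
    and simple_roots_independent: "independent (\<alpha> ` S)"
    and roots_decompose: "roots W S act \<alpha> = positive_roots W S act \<alpha> \<union> negative_roots W S act \<alpha>"
    and roots_reduced: "\<beta> \<in> roots W S act \<alpha> \<Longrightarrow> c *\<^sub>R \<beta> \<in> roots W S act \<alpha> \<Longrightarrow> c = 1 \<or> c = - 1"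

definition coxeter_length :: "('w, 'm) monoid_scheme \<Rightarrow> 'w set \<Rightarrow> 'w \<Rightarrow> nat" where
  "coxeter_length W S w = (LEAST n. \<exists>ws \<in> lists S. length ws = n \<and> word_prod W ws = w)"

definition reduced_expression :: "('w, 'm) monoid_scheme \<Rightarrow> 'w set \<Rightarrow> 'w list \<Rightarrow> 'w \<Rightarrow> bool" where
  "reduced_expression W S ws w \<longleftrightarrow>
     ws \<in> lists S \<and> word_prod W ws = w \<and> length ws = coxeter_length W S w"


section \<open>Subword complexes\<close>

text \<open>Positions in a word are numbered from \<open>1\<close>, whereas list indexing starts at \<open>0\<close>.\<close>

definition subword :: "'w list \<Rightarrow> nat set \<Rightarrow> 'w list" where
  "subword Q X = nths Q {k. Suc k \<in> X}"

definition subword_prod :: "('w, 'm) monoid_scheme \<Rightarrow> 'w list \<Rightarrow> nat set \<Rightarrow> 'w" where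
  "subword_prod W Q X = word_prod W (subword Q X)"

definition facets :: "('w, 'm) monoid_scheme \<Rightarrow> 'w set \<Rightarrow> 'w list \<Rightarrow> 'w \<Rightarrow> nat set set" where
  "facets W S Q \<rho> =
     {I. I \<subseteq> {1..length Q} \<and> reduced_expression W S (subword Q ({1..length Q} - I)) \<rho>}"

definition root_function ::
  "('w, 'm) monoid_scheme \<Rightarrow> ('w \<Rightarrow> 'v \<Rightarrow> 'v) \<Rightarrow> ('w \<Rightarrow> 'v) \<Rightarrow> 'w list \<Rightarrow> nat set \<Rightarrow> nat \<Rightarrow> 'v" where
  "root_function W act \<alpha> Q I k = act (subword_prod W Q ({1..k - 1} - I)) (\<alpha> (Q ! (k - 1)))"

text \<open>\<open>is_flip W S Q \<rho> I i J\<close>: the facet \<open>J\<close> is obtained from the facet \<open>I\<close> by flipping \<open>i\<close>.\<close>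

definition is_flip ::
  "('w, 'm) monoid_scheme \<Rightarrow> 'w set \<Rightarrow> 'w list \<Rightarrow> 'w \<Rightarrow> nat set \<Rightarrow> nat \<Rightarrow> nat set \<Rightarrow> bool" where
  "is_flip W S Q \<rho> I i J \<longleftrightarrow> I \<in> facets W S Q \<rho> \<and> J \<in> facets W S Q \<rho> \<and> I \<noteq> J \<and>
     i \<in> I \<and> (\<exists>j\<in>J. I - {i} = J - {j})"

text \<open>The edges \<open>I \<rightarrow> J\<close> of the increasing flip graph, whose vertices are the facets.\<close>

definition increasing_flip ::
  "('w, 'm) monoid_scheme \<Rightarrow> 'w set \<Rightarrow> 'w list \<Rightarrow> 'w \<Rightarrow> nat set \<Rightarrow> nat set \<Rightarrow> bool" where
  "increasing_flip W S Q \<rho> I J \<longleftrightarrow> I \<in> facets W S Q \<rho> \<and> J \<in> facets W S Q \<rho> \<and> I \<noteq> J \<and>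
     (\<exists>i\<in>I. \<exists>j\<in>J. I - {i} = J - {j} \<and> i < j)"

definition n_label :: "nat set \<Rightarrow> nat set \<Rightarrow> nat" where
  "n_label I J = (THE j. j \<in> J \<and> (\<exists>i\<in>I. I - {i} = J - {j}))"

text \<open>A path is given by the non-empty list of its successive facets.\<close>

definition n_rising_path ::
  "('w, 'm) monoid_scheme \<Rightarrow> 'w set \<Rightarrow> 'w list \<Rightarrow> 'w \<Rightarrow> nat set list \<Rightarrow> bool" where
  "n_rising_path W S Q \<rho> p \<longleftrightarrow> p \<noteq> [] \<and> set p \<subseteq> facets W S Q \<rho> \<and>
     successively (increasing_flip W S Q \<rho>) p \<and>
     sorted_wrt (<) (map2 n_label p (tl p))"

text \<open>The unique sink of the increasing flip graph; meaningful only if there is a facet.\<close>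

definition neg_greedy :: "('w, 'm) monoid_scheme \<Rightarrow> 'w set \<Rightarrow> 'w list \<Rightarrow> 'w \<Rightarrow> nat set" where
  "neg_greedy W S Q \<rho> =
     (THE I. I \<in> facets W S Q \<rho> \<and> (\<nexists>J. increasing_flip W S Q \<rho> I J))"

text \<open>The negative sink tree consists of the n-rising paths from the facets to its root, the
  negative greedy facet. The father of \<open>I\<close> is the facet following \<open>I\<close> on the unique n-rising path
  from \<open>I\<close> to the root; it is meaningful only if \<open>I\<close> is a facet other than the root.\<close>

definition father ::
  "('w, 'm) monoid_scheme \<Rightarrow> 'w set \<Rightarrow> 'w list \<Rightarrow> 'w \<Rightarrow> nat set \<Rightarrow> nat set" where
  "father W S Q \<rho> I =
     (THE J. \<exists>p. n_rising_path W S Q \<rho> (I # J # p) \<and> last (I # J # p) = neg_greedy W S Q \<rho>)"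

end

theory Submission
  imports Defs
begin

text \<open>For a facet \<open>I\<close>, flipping \<open>i \<in> I\<close> to a later \<open>j \<notin> I\<close> is possible exactly if
  \<open>q\<^sub>i u = u q\<^sub>j\<close>, where \<open>u\<close> is the product of the letters strictly between \<open>i\<close> and \<open>j\<close> outside \<open>I\<close>;
  by reducedness this says that the root function agrees on \<open>i\<close> and \<open>j\<close>. By the exchange condition
  such a \<open>j \<le> k\<close> exists if and only if \<open>q\<^sub>i\<close> is a left descent of the product of the letters in
  \<open>(i, k] - I\<close>, a criterion that depends on a product in \<open>W\<close> only and is therefore insensitive to
  flips happening inside \<open>(i, k]\<close>.

  Order the possible increasing flips \<open>i \<rightarrow> j\<close> of \<open>I\<close> lexicographically by \<open>(j, i)\<close>. If \<open>i \<rightarrow> j\<close> is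
  the first one, then the flipped facet has no increasing flip inside \<open>[j]\<close>; iterating, one obtains an
  \<open>n\<close>-rising path to the sink. Conversely, if after flipping \<open>i \<rightarrow> j\<close> no increasing flip inside \<open>[j]\<close>
  is left, then \<open>i \<rightarrow> j\<close> was the first flip of \<open>I\<close>; going backwards along an arbitrary \<open>n\<close>-rising path
  ending in the sink shows that all its steps are first flips. The positions \<open>y\<close> and \<open>x\<close> of the theorem
  are the two ends of the first flip of \<open>I\<close>.\<close>

section \<open>Roots and the exchange condition\<close>

(* These rules turn membership in lists S into a quantified formula, which no longer matches the
   side conditions of the lemmas on word products. *)
declare in_listsD [rule del] in_listsI [rule del]

lemma rev_in_lists_iff [simp]: "rev ws \<in> lists A \<longleftrightarrow> ws \<in> lists A"
  by (simp add: in_lists_conv_set)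

section \<open>Word products and length in a Coxeter system\<close>

context coxeter_system
begin

abbreviation len :: "'w \<Rightarrow> nat" where
  "len \<equiv> coxeter_length W S"

lemma generator_closed: "s \<in> S \<Longrightarrow> s \<in> carrier W"
  using generators_closed by blast

lemma generator_square: "s \<in> S \<Longrightarrow> s \<otimes> s = \<one>"
  using generators_involutive[of s] pow_ord_eq_1[of s] generator_closed[of s]
  by (simp add: numeral_2_eq_2)

lemma generator_inv: "s \<in> S \<Longrightarrow> inv s = s"
  using generator_square generator_closed inv_equality by blast

lemma generator_cancel: "s \<in> S \<Longrightarrow> g \<in> carrier W \<Longrightarrow> s \<otimes> (s \<otimes> g) = g"
  by (metis generator_square generator_closed l_one m_assoc)

lemma word_prod_Nil [simp]: "word_prod W [] = \<one>"
  by (simp add: word_prod_def)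

lemma word_prod_Cons [simp]: "word_prod W (s # ws) = s \<otimes> word_prod W ws"
  by (simp add: word_prod_def)

lemma word_prod_closed [simp]: "ws \<in> lists S \<Longrightarrow> word_prod W ws \<in> carrier W"
  by (induction ws) (auto simp: generator_closed)

lemma word_prod_append [simp]:
  "us \<in> lists S \<Longrightarrow> vs \<in> lists S \<Longrightarrow> word_prod W (us @ vs) = word_prod W us \<otimes> word_prod W vs"
  by (induction us) (auto simp: generator_closed m_assoc)

lemma word_prod_rev: "ws \<in> lists S \<Longrightarrow> word_prod W (rev ws) = inv (word_prod W ws)"
  by (induction ws) (auto simp: generator_closed inv_mult_group generator_inv)

text \<open>Generators are their own inverses, so the subgroup they generate consists of products of
  words without formal inverses.\<close>

lemma ex_word:
  assumes "w \<in> carrier W"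
  shows "\<exists>ws \<in> lists S. word_prod W ws = w"
proof -
  have "w \<in> generate W S" using assms generates by simp
  then show ?thesis
  proof induction
    case one
    show ?case by (intro bexI[of _ "[]"]) auto
  next
    case (incl h)
    then show ?case by (intro bexI[of _ "[h]"]) (auto simp: generator_closed)
  next
    case (inv h)
    then show ?case by (intro bexI[of _ "[h]"]) (auto simp: generator_closed generator_inv)
  next
    case (eng g h)
    then show ?case by (metis append_in_lists_conv word_prod_append)
  qed
qed

lemma len_word_prod_le: "ws \<in> lists S \<Longrightarrow> len (word_prod W ws) \<le> length ws"
  unfolding coxeter_length_def by (rule Least_le) auto

lemma ex_reduced_word:
  assumes "w \<in> carrier W"
  obtains ws where "ws \<in> lists S" "word_prod W ws = w" "length ws = len w"
proof -
  have "\<exists>n. \<exists>ws \<in> lists S. length ws = n \<and> word_prod W ws = w"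
    using ex_word[OF assms] by blast
  from LeastI_ex[OF this] show ?thesis
    using that unfolding coxeter_length_def by blast
qed

lemma len_mult_le:
  assumes "u \<in> carrier W" "v \<in> carrier W"
  shows "len (u \<otimes> v) \<le> len u + len v"
  by (metis assms append_in_lists_conv ex_reduced_word len_word_prod_le length_append word_prod_append)

end

section \<open>The orthogonal action, signs of roots, and the exchange condition\<close>

context finite_coxeter_realization
begin

abbreviation pos where "pos \<equiv> positive_roots W S act \<alpha>"
abbreviation neg where "neg \<equiv> negative_roots W S act \<alpha>"

lemma act_mult: "u \<in> carrier W \<Longrightarrow> v \<in> carrier W \<Longrightarrow> act (u \<otimes> v) x = act u (act v x)"
  by (rule composition_rule) auto

lemma act_one [simp]: "act \<one> x = x"
  by (metis id_eq_one restrict_apply UNIV_I)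

lemma finite_generators: "finite S"
  using finite_carrier generators_closed finite_subset by blast

lemma simple_root_nonzero: "s \<in> S \<Longrightarrow> \<alpha> s \<noteq> 0"
  using simple_roots_independent dependent_zero by (metis imageI)

lemma orthogonal_transformation_reflection:
  "a \<noteq> 0 \<Longrightarrow> orthogonal_transformation (reflection a)"
  unfolding orthogonal_transformation_def
proof (intro conjI allI)
  assume "a \<noteq> 0"
  then have [simp]: "a \<bullet> a \<noteq> 0" by simp
  show "linear (reflection a)"
  proof (rule linearI)
    fix v w c
    show "reflection a (v + w) = reflection a v + reflection a w"
      by (simp add: reflection_def inner_add_left distrib_left add_divide_distrib scaleR_add_left)
    show "reflection a (c *\<^sub>R v) = c *\<^sub>R reflection a v"
      by (simp add: reflection_def scaleR_diff_right mult.left_commute)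
  qed
  show "reflection a v \<bullet> reflection a w = v \<bullet> w" for v w
  proof -
    \<comment> \<open>Naming both quotients keeps the expansion free of division: only their
      products with \<open>a \<bullet> a\<close> matter.\<close>
    define p where "p = 2 * (v \<bullet> a) / (a \<bullet> a)"
    define q where "q = 2 * (w \<bullet> a) / (a \<bullet> a)"
    have p: "p * (a \<bullet> a) = 2 * (v \<bullet> a)" and q: "q * (a \<bullet> a) = 2 * (w \<bullet> a)"
      by (simp_all add: p_def q_def)
    have "reflection a v \<bullet> reflection a w
        = v \<bullet> w - q * (v \<bullet> a) - p * (w \<bullet> a) + q * (p * (a \<bullet> a))"
      unfolding reflection_def p_def[symmetric] q_def[symmetric]
      by (simp add: inner_diff_left inner_diff_right inner_commute algebra_simps)
    moreover have "q * (p * (a \<bullet> a)) = 2 * (q * (v \<bullet> a))"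
      "2 * (p * (w \<bullet> a)) = p * (q * (a \<bullet> a))"
      by (simp_all add: p q)
    moreover have "p * (q * (a \<bullet> a)) = q * (p * (a \<bullet> a))"
      by (rule mult.left_commute)
    ultimately show ?thesis by linarith
  qed
qed

text \<open>Only the generators are known to act as reflections, so orthogonality is carried along a
  word for \<open>w\<close>.\<close>

lemma orthogonal_transformation_act:
  assumes "w \<in> carrier W"
  shows "orthogonal_transformation (act w)"
proof -
  have "orthogonal_transformation (act (word_prod W ws))" if "ws \<in> lists S" for ws
    using that
  proof (induction ws)
    case Nil
    have "act \<one> = id" by auto
    then show ?case by (simp add: orthogonal_transformation_id id_def)
  next
    case (Cons s ws)
    then have "act (s \<otimes> word_prod W ws) = act s \<circ> act (word_prod W ws)"
      by (auto simp: act_mult generator_closed)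
    moreover have "orthogonal_transformation (act s)"
      using Cons.hyps
      by (simp only: generator_acts orthogonal_transformation_reflection simple_root_nonzero
          not_False_eq_True)
    ultimately show ?case using Cons
      by (simp add: orthogonal_transformation_compose del: o_apply comp_apply)
  qed
  then show ?thesis using ex_word[OF assms] by blast
qed

lemma act_reflection:
  assumes "w \<in> carrier W"
  shows "act w (reflection a x) = reflection (act w a) (act w x)"
  using orthogonal_transformation_act[OF assms]
  by (simp add: orthogonal_transformation_def reflection_def linear_diff linear_scale)

lemma act_uminus: "w \<in> carrier W \<Longrightarrow> act w (- x) = - act w x"
  using orthogonal_transformation_act by (simp add: orthogonal_transformation_def linear_neg)

lemma act_simple_root: "s \<in> S \<Longrightarrow> act s (\<alpha> s) = - \<alpha> s"
  using simple_root_nonzero by (simp add: generator_acts reflection_def scaleR_2)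

lemma act_in_roots:
  "w \<in> carrier W \<Longrightarrow> \<beta> \<in> roots W S act \<alpha> \<Longrightarrow> act w \<beta> \<in> roots W S act \<alpha>"
  unfolding roots_def using act_mult by (smt (verit) m_closed mem_Collect_eq)

lemma simple_in_roots: "s \<in> S \<Longrightarrow> \<alpha> s \<in> roots W S act \<alpha>"
  unfolding roots_def by (metis (mono_tags, lifting) act_one mem_Collect_eq one_closed)

lemma simple_root_combination_unique:
  assumes "(\<Sum>s\<in>S. c s *\<^sub>R \<alpha> s) = (\<Sum>s\<in>S. d s *\<^sub>R \<alpha> s)" "s \<in> S"
  shows "c s = d s"
proof -
  \<comment> \<open>Independence speaks of the vectors in the image of \<open>S\<close>, so
    coefficients indexed by \<open>S\<close> are pulled back along the injection
    \<open>\<alpha>\<close>.\<close>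
  let ?u = "\<lambda>v. c (the_inv_into S \<alpha> v) - d (the_inv_into S \<alpha> v)"
  have "(\<Sum>v\<in>\<alpha> ` S. ?u v *\<^sub>R v) = (\<Sum>s\<in>S. (c s - d s) *\<^sub>R \<alpha> s)"
    by (simp add: sum.reindex[OF simple_roots_inj] the_inv_into_f_f[OF simple_roots_inj])
  also have "\<dots> = 0"
    using assms(1) by (simp add: scaleR_diff_left sum_subtractf)
  finally have "?u (\<alpha> s) = 0"
    using independentD[OF simple_roots_independent _ subset_refl, of ?u "\<alpha> s"]
      finite_generators assms(2)
    by simp
  then show ?thesis
    using assms(2) by (simp add: the_inv_into_f_f[OF simple_roots_inj])
qed

lemma simple_root_combination:
  "s \<in> S \<Longrightarrow> \<alpha> s = (\<Sum>t\<in>S. (if t = s then 1 else 0) *\<^sub>R \<alpha> t)"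
  using finite_generators by (simp add: if_distrib[of "\<lambda>c. c *\<^sub>R _"] cong: if_cong)

lemma simple_root_pos: "s \<in> S \<Longrightarrow> \<alpha> s \<in> pos"
  unfolding positive_roots_def
  using simple_in_roots simple_root_combination
  by (auto intro!: exI[of _ "\<lambda>t. if t = s then 1 else 0"])

lemma root_cases: "\<beta> \<in> roots W S act \<alpha> \<Longrightarrow> \<beta> \<in> pos \<or> \<beta> \<in> neg"
  using roots_decompose by blast

lemma neg_iff: "\<beta> \<in> neg \<longleftrightarrow> - \<beta> \<in> pos"
  unfolding negative_roots_def by force

lemma pos_in_roots: "\<beta> \<in> pos \<Longrightarrow> \<beta> \<in> roots W S act \<alpha>"
  by (simp add: positive_roots_def)

text \<open>Nonnegative expansions of both \<open>\<beta>\<close> and \<open>- \<beta>\<close> force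
  all coefficients to vanish by independence. But a root is not zero, being the image of a simple
  root under a norm-preserving map.\<close>

lemma pos_not_neg:
  assumes "\<beta> \<in> pos"
  shows "\<beta> \<notin> neg"
proof
  assume "\<beta> \<in> neg"
  obtain c where c: "\<And>s. s \<in> S \<Longrightarrow> 0 \<le> c s" "\<beta> = (\<Sum>s\<in>S. c s *\<^sub>R \<alpha> s)"
    using assms unfolding positive_roots_def by blast
  obtain d where d: "\<And>s. s \<in> S \<Longrightarrow> 0 \<le> d s" "- \<beta> = (\<Sum>s\<in>S. d s *\<^sub>R \<alpha> s)"
    using \<open>\<beta> \<in> neg\<close> unfolding neg_iff positive_roots_def by blast
  have "\<beta> = (\<Sum>s\<in>S. (- d s) *\<^sub>R \<alpha> s)"
    using d(2) by (simp add: sum_negf minus_equation_iff[of \<beta>])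
  then have "c s = - d s" if "s \<in> S" for s
    using simple_root_combination_unique[of c "\<lambda>s. - d s"] c(2) that by simp
  then have "c s = 0" if "s \<in> S" for s
    using c(1) d(1) that by (metis neg_0_equal_iff_equal neg_le_0_iff_le order_antisym)
  then have "\<beta> = 0" using c(2) by simp
  moreover obtain w s where "w \<in> carrier W" "s \<in> S" "\<beta> = act w (\<alpha> s)"
    using pos_in_roots[OF assms] unfolding roots_def by blast
  ultimately show False
    using simple_root_nonzero orthogonal_transformation_act orthogonal_transformation_norm
    by (metis norm_eq_zero)
qed

text \<open>A simple reflection changes only one coefficient, so the coefficients of \<open>\<beta>\<close> away from
  \<open>\<alpha> s\<close> vanish as soon as its image is negative.\<close>

lemma reflected_neg_imp_simple:
  assumes "\<beta> \<in> pos" "s \<in> S" "act s \<beta> \<in> neg"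
  shows "\<beta> = \<alpha> s"
proof -
  obtain c where c: "\<And>t. t \<in> S \<Longrightarrow> 0 \<le> c t" "\<beta> = (\<Sum>t\<in>S. c t *\<^sub>R \<alpha> t)"
    using assms(1) unfolding positive_roots_def by blast
  obtain d where d: "\<And>t. t \<in> S \<Longrightarrow> 0 \<le> d t" "- act s \<beta> = (\<Sum>t\<in>S. d t *\<^sub>R \<alpha> t)"
    using assms(3) unfolding neg_iff positive_roots_def by blast
  obtain k where k: "act s \<beta> = \<beta> - k *\<^sub>R \<alpha> s"
    unfolding generator_acts[OF assms(2)] reflection_def by blast
  have "(\<Sum>t\<in>S. (k * (if t = s then 1 else 0)) *\<^sub>R \<alpha> t) = k *\<^sub>R \<alpha> s"
    unfolding scaleR_scaleR[symmetric] scaleR_sum_right[symmetric]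
    using simple_root_combination[OF assms(2)] by simp
  also have "\<dots> = (\<Sum>t\<in>S. (c t + d t) *\<^sub>R \<alpha> t)"
    unfolding scaleR_add_left sum.distrib c(2)[symmetric] d(2)[symmetric] k by simp
  finally have sum_eq: "c t + d t = k * (if t = s then 1 else 0)" if "t \<in> S" for t
    using simple_root_combination_unique[of _ "\<lambda>t. c t + d t"] that by metis
  have zero: "c t = 0" if "t \<in> S" "t \<noteq> s" for t
  proof -
    have "c t + d t = 0" using sum_eq[OF that(1)] that(2) by simp
    then show ?thesis using c(1)[OF that(1)] d(1)[OF that(1)] by linarith
  qed
  have "\<beta> = (\<Sum>t\<in>S. c s *\<^sub>R ((if t = s then 1 else 0) *\<^sub>R \<alpha> t))"
    unfolding c(2) using zero by (intro sum.cong) auto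
  also have "\<dots> = c s *\<^sub>R \<alpha> s"
    unfolding scaleR_sum_right[symmetric] using simple_root_combination[OF assms(2)] by simp
  finally have "\<beta> = c s *\<^sub>R \<alpha> s" .
  moreover from this have "c s = 1 \<or> c s = - 1"
    using roots_reduced[of "\<alpha> s" "c s"] assms simple_in_roots pos_in_roots by blast
  ultimately show ?thesis using c(1)[OF assms(2)] by auto
qed

text \<open>The equation says that conjugation by \<open>w\<close> turns \<open>t\<close> into
  \<open>s\<close>, that is, that the reflections in \<open>act w (\<alpha> t)\<close> and
  \<open>\<alpha> s\<close> coincide. Proportional roots agree up to sign, and faithfulness gives
  the converse.\<close>

lemma commute_iff_root:
  assumes "w \<in> carrier W" "s \<in> S" "t \<in> S"
  shows "s \<otimes> w = w \<otimes> t \<longleftrightarrow> act w (\<alpha> t) = \<alpha> s \<or> act w (\<alpha> t) = - \<alpha> s"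
proof
  assume eq: "s \<otimes> w = w \<otimes> t"
  let ?\<beta> = "act w (\<alpha> t)"
  have "act (s \<otimes> w) (\<alpha> t) = - ?\<beta>"
    using assms by (simp add: eq act_mult act_simple_root act_uminus generator_closed)
  then have refl: "reflection (\<alpha> s) ?\<beta> = - ?\<beta>"
    using assms by (simp add: act_mult generator_closed generator_acts)
  \<comment> \<open>A vector negated by the reflection in \<open>\<alpha> s\<close> equals its
    projection onto that line; \<open>k\<close> is the coefficient of this projection.\<close>
  define k where "k = ?\<beta> \<bullet> \<alpha> s / (\<alpha> s \<bullet> \<alpha> s)"
  have "2 *\<^sub>R ?\<beta> = 2 *\<^sub>R (k *\<^sub>R \<alpha> s)"
    using refl unfolding reflection_def k_def
    by (simp add: scaleR_2 algebra_simps)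
  then have "?\<beta> = k *\<^sub>R \<alpha> s" by (simp only: scaleR_cancel_left) simp
  moreover have "?\<beta> \<in> roots W S act \<alpha>" using assms act_in_roots simple_in_roots by blast
  ultimately have "k = 1 \<or> k = - 1"
    using roots_reduced simple_in_roots assms by metis
  with \<open>?\<beta> = k *\<^sub>R \<alpha> s\<close> show "?\<beta> = \<alpha> s \<or> ?\<beta> = - \<alpha> s" by auto
next
  assume "act w (\<alpha> t) = \<alpha> s \<or> act w (\<alpha> t) = - \<alpha> s"
  then have "reflection (act w (\<alpha> t)) x = reflection (\<alpha> s) x" for x
    by (auto simp: reflection_def)
  then have "act (s \<otimes> w) x = act (w \<otimes> t) x" for x
    using assms by (simp add: act_mult generator_closed generator_acts act_reflection)
  then have "act (s \<otimes> w) = act (w \<otimes> t)" by blast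
  then show "s \<otimes> w = w \<otimes> t"
    using faithful assms by (simp add: inj_on_eq_iff generator_closed)
qed

text \<open>Apply the letters to \<open>\<alpha> t\<close> from right to left. The root starts
  positive and ends negative, and a letter \<open>s\<close> can make a positive root negative only
  if that root is \<open>\<alpha> s\<close>; there \<open>commute_iff_root\<close> applies.\<close>

lemma exchange_of_neg:
  assumes "ws \<in> lists S" "t \<in> S" "act (word_prod W ws) (\<alpha> t) \<in> neg"
  shows "\<exists>us s vs. ws = us @ s # vs \<and> s \<otimes> word_prod W vs = word_prod W vs \<otimes> t"
  using assms
proof (induction ws)
  case Nil
  then show ?case using pos_not_neg simple_root_pos by auto
next
  case (Cons s ws)
  let ?\<beta> = "act (word_prod W ws) (\<alpha> t)"
  show ?case
  proof (cases "?\<beta> \<in> neg")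
    case True
    then show ?thesis using Cons by (metis append_Cons in_lists_conv_set list.set_intros(2))
  next
    case False
    then have "?\<beta> \<in> pos"
      using root_cases[OF act_in_roots[OF word_prod_closed simple_in_roots], of ws t] Cons.hyps
        Cons.prems
      by simp
    moreover have "act s ?\<beta> \<in> neg"
      using Cons by (auto simp: act_mult generator_closed)
    ultimately have "?\<beta> = \<alpha> s"
      using reflected_neg_imp_simple Cons.hyps(1) by blast
    then have "s \<otimes> word_prod W ws = word_prod W ws \<otimes> t"
      using commute_iff_root Cons.hyps(1,2) Cons.prems(1) word_prod_closed by blast
    then show ?thesis by (metis append_Nil)
  qed
qed

text \<open>In a reduced word of \<open>w\<close>, the exchange moves \<open>t\<close> to the left
  until it cancels a letter.\<close>

lemma len_decreases_of_neg:
  assumes "w \<in> carrier W" "t \<in> S" "act w (\<alpha> t) \<in> neg"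
  shows "len (w \<otimes> t) < len w"
proof -
  obtain ws where ws: "ws \<in> lists S" "word_prod W ws = w" "length ws = len w"
    using ex_reduced_word[OF assms(1)] .
  obtain us s vs where e: "ws = us @ s # vs" "s \<otimes> word_prod W vs = word_prod W vs \<otimes> t"
    using exchange_of_neg[OF ws(1) assms(2)] assms(3) ws(2) by auto
  have "us \<in> lists S" "vs \<in> lists S" "s \<in> S" using ws(1) e(1) by auto
  then have "w \<otimes> t = word_prod W us \<otimes> (s \<otimes> (word_prod W vs \<otimes> t))"
    using ws(2) e(1) assms(2) by (auto simp: m_assoc generator_closed)
  also have "\<dots> = word_prod W (us @ vs)"
    using \<open>us \<in> lists S\<close> \<open>vs \<in> lists S\<close> \<open>s \<in> S\<close>
    by (simp add: e(2)[symmetric] generator_cancel)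
  finally show ?thesis
    using len_word_prod_le[of "us @ vs"] \<open>us \<in> lists S\<close> \<open>vs \<in> lists S\<close> ws(3) e(1) by simp
qed

text \<open>Growth of the length excludes the negative sign left open by
  \<open>commute_iff_root\<close>.\<close>

lemma root_eq_of_commute:
  assumes "w \<in> carrier W" "s \<in> S" "t \<in> S" "s \<otimes> w = w \<otimes> t" "len w < len (w \<otimes> t)"
  shows "act w (\<alpha> t) = \<alpha> s"
proof -
  have "act w (\<alpha> t) \<noteq> - \<alpha> s"
    using len_decreases_of_neg[OF assms(1,3)] assms(5) simple_root_pos[OF assms(2)]
    by (auto simp: neg_iff)
  then show ?thesis using commute_iff_root assms by blast
qed

lemma exchange_condition:
  assumes "ws \<in> lists S" "s \<in> S" "len (s \<otimes> word_prod W ws) < len (word_prod W ws)"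
  shows "\<exists>us t vs. ws = us @ t # vs \<and> s \<otimes> word_prod W us = word_prod W us \<otimes> t"
proof -
  let ?w = "word_prod W ws"
  \<comment> \<open>Left-handed version of \<open>exchange_of_neg\<close>: reversing a word inverts
    its product.\<close>
  have rev: "\<exists>us t vs. vs' = us @ t # vs \<and> s \<otimes> word_prod W us = word_prod W us \<otimes> t"
    if vs_in: "vs' \<in> lists S" and vs_neg: "act (inv (word_prod W vs')) (\<alpha> s) \<in> neg" for vs'
  proof -
    have "\<exists>us t vs. rev vs' = us @ t # vs \<and> t \<otimes> word_prod W vs = word_prod W vs \<otimes> s"
      by (rule exchange_of_neg) (use vs_in vs_neg assms(2) in \<open>simp_all add: word_prod_rev\<close>)
    then obtain us t vs where e: "rev vs' = us @ t # vs"
      "t \<otimes> word_prod W vs = word_prod W vs \<otimes> s" by blast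
    have vs': "vs' = rev vs @ t # rev us" using e(1) by (simp add: rev_swap)
    then have "t \<in> S" "vs \<in> lists S" using vs_in by auto
    then have "word_prod W (rev vs) \<otimes> t = s \<otimes> word_prod W (rev vs)"
      using arg_cong[OF e(2), of "m_inv W"] assms(2)
      by (simp add: word_prod_rev inv_mult_group generator_closed generator_inv)
    then show ?thesis using vs' by metis
  qed
  \<comment> \<open>Were this root positive, the one for \<open>s \<otimes> ?w\<close> would be
    negative. Exchange in a reduced word of \<open>s \<otimes> ?w\<close> would then give a shorter
    word for \<open>?w\<close>, contradicting the assumed drop in length.\<close>
  have "act (inv ?w) (\<alpha> s) \<in> neg"
  proof (rule ccontr)
    assume "act (inv ?w) (\<alpha> s) \<notin> neg"
    then have "act (inv ?w) (\<alpha> s) \<in> pos"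
      using root_cases[OF act_in_roots[OF _ simple_in_roots[OF assms(2)]], of "inv ?w"] assms(1)
      by simp
    moreover have "act (inv (s \<otimes> ?w)) (\<alpha> s) = - act (inv ?w) (\<alpha> s)"
      using assms by (simp add: inv_mult_group generator_inv generator_closed act_mult
          act_simple_root act_uminus)
    ultimately have n: "act (inv (s \<otimes> ?w)) (\<alpha> s) \<in> neg" by (simp add: neg_iff)
    obtain us where us: "us \<in> lists S" "word_prod W us = s \<otimes> ?w" "length us = len (s \<otimes> ?w)"
      using ex_reduced_word[of "s \<otimes> ?w"] assms generator_closed by auto
    obtain xs t ys where e: "us = xs @ t # ys" "s \<otimes> word_prod W xs = word_prod W xs \<otimes> t"
      using rev[OF us(1)] n us(2) by auto
    have l: "xs \<in> lists S" "t \<in> S" "ys \<in> lists S" using us(1) e(1) by auto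
    have "?w = s \<otimes> word_prod W us" using us(2) assms generator_cancel by simp
    also have "\<dots> = (s \<otimes> word_prod W xs) \<otimes> (t \<otimes> word_prod W ys)"
      using l assms(2) e(1) by (simp add: m_assoc generator_closed)
    also have "\<dots> = word_prod W (xs @ ys)"
      unfolding e(2) using l by (simp add: m_assoc generator_closed generator_cancel)
    finally have "len ?w \<le> length (xs @ ys)" using l by (metis append_in_lists_conv len_word_prod_le)
    then show False using e(1) us(3) assms(3) by simp
  qed
  then show ?thesis using rev assms(1) by blast
qed

end

section \<open>Subwords and flips\<close>

(* Keeps the positions k - 1 syntactically as they occur in the definitions. *)
declare One_nat_def [simp del]

section \<open>Subwords selected by sets of positions\<close>

lemma subword_snoc:
  "subword (Q @ [a]) X = subword Q X @ (if Suc (length Q) \<in> X then [a] else [])"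
  by (simp add: subword_def nths_append)

lemma subword_Nil [simp]: "subword [] X = []"
  by (simp add: subword_def)

lemma length_subword: "length (subword Q X) = card (X \<inter> {1..length Q})"
proof (induction Q rule: rev_induct)
  case (snoc a Q)
  have "X \<inter> {1..length (Q @ [a])} =
      (X \<inter> {1..length Q}) \<union> (if Suc (length Q) \<in> X then {Suc (length Q)} else {})"
    by (simp add: atLeastAtMostSuc_conv Int_insert_right)
  then show ?case using snoc by (simp add: subword_snoc card_insert_if)
qed simp

lemma subword_cong: "X \<inter> {1..length Q} = Y \<inter> {1..length Q} \<Longrightarrow> subword Q X = subword Q Y"
proof (induction Q rule: rev_induct)
  case (snoc a Q)
  have mem: "k \<in> X \<longleftrightarrow> k \<in> Y" if "1 \<le> k" "k \<le> Suc (length Q)" for k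
    using snoc.prems that by (auto simp: set_eq_iff)
  then have "X \<inter> {1..length Q} = Y \<inter> {1..length Q}" by auto
  then show ?case using snoc.IH mem[of "Suc (length Q)"] by (simp add: subword_snoc)
qed simp

lemma subword_disjoint: "X \<inter> {1..length Q} = {} \<Longrightarrow> subword Q X = []"
  using subword_cong[of X Q "{}"] by (simp add: subword_def)

lemma subword_take: "subword (take k Q) X = subword Q (X \<inter> {..k})"
proof (induction Q rule: rev_induct)
  case (snoc a Q)
  show ?case
  proof (cases "k \<le> length Q")
    case True
    then show ?thesis using snoc by (simp add: subword_snoc)
  next
    case False
    then have "take k (Q @ [a]) = Q @ [a]" by simp
    moreover have "subword (Q @ [a]) X = subword (Q @ [a]) (X \<inter> {..k})"
      by (rule subword_cong) (use False in auto)
    ultimately show ?thesis by simp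
  qed
qed simp

lemma subword_split: "subword Q X = subword Q (X \<inter> {..k}) @ subword Q (X \<inter> {k<..})"
proof (induction Q rule: rev_induct)
  case (snoc a Q)
  have "subword Q (X \<inter> {k<..}) = []" if "Suc (length Q) \<le> k"
    by (rule subword_disjoint) (use that in auto)
  then show ?case using snoc by (auto simp: subword_snoc)
qed simp

lemma subword_singleton:
  "1 \<le> k \<Longrightarrow> k \<le> length Q \<Longrightarrow> subword Q {k} = [Q ! (k - 1)]"
proof (induction Q rule: rev_induct)
  case (snoc a Q)
  have "subword Q {Suc (length Q)} = []"
    by (rule subword_disjoint) simp
  then show ?case using snoc by (auto simp: subword_snoc nth_append le_Suc_eq)
qed simp

text \<open>The exchange condition splits a list; this recovers the position in \<open>Q\<close> of
  the letter at the split.\<close>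

lemma subword_eq_appendD:
  "subword Q X = us @ t # vs \<Longrightarrow>
    \<exists>j \<in> X \<inter> {1..length Q}. us = subword Q (X \<inter> {..<j}) \<and> t = Q ! (j - 1)"
proof (induction Q arbitrary: vs rule: rev_induct)
  case (snoc a Q)
  show ?case
  proof (cases "Suc (length Q) \<in> X \<and> vs = []")
    case True
    then have us: "us = subword Q X" and t: "t = a"
      using snoc.prems by (simp_all add: subword_snoc)
    have "us = subword (Q @ [a]) (X \<inter> {..<Suc (length Q)})"
      unfolding us subword_snoc by (simp, rule subword_cong) auto
    then show ?thesis using True t by (intro bexI[of _ "Suc (length Q)"]) auto
  next
    case False
    then have "\<exists>vs'. subword Q X = us @ t # vs'"
      using snoc.prems by (cases vs rule: rev_cases) (auto simp: subword_snoc split: if_splits)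
    then obtain j where j: "j \<in> X \<inter> {1..length Q}" "us = subword Q (X \<inter> {..<j})" "t = Q ! (j - 1)"
      using snoc.IH by blast
    then have "us = subword (Q @ [a]) (X \<inter> {..<j})" "t = (Q @ [a]) ! (j - 1)"
      by (auto simp: subword_snoc nth_append)
    then show ?thesis using j(1) by auto
  qed
qed simp

text \<open>This encodes an increasing flip from \<open>i\<close> to \<open>j\<close>. It involves
  \<open>I\<close> only between \<open>i\<close> and \<open>j\<close>, so it can be moved between
  facets agreeing there and to prefixes of the word.\<close>

definition exchangeable ::
  "('w, 'm) monoid_scheme \<Rightarrow> 'w list \<Rightarrow> nat set \<Rightarrow> nat \<Rightarrow> nat \<Rightarrow> bool" where
  "exchangeable W Q I i j \<longleftrightarrow> i \<in> I \<and> 1 \<le> i \<and> j \<notin> I \<and> i < j \<and> j \<le> length Q \<and>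
     Q ! (i - 1) \<otimes>\<^bsub>W\<^esub> subword_prod W Q ({i<..<j} - I) =
     subword_prod W Q ({i<..<j} - I) \<otimes>\<^bsub>W\<^esub> Q ! (j - 1)"

lemma n_label_flip:
  assumes "i \<in> I" "j \<notin> I" "i \<noteq> j"
  shows "n_label I (insert j (I - {i})) = j"
  unfolding n_label_def
proof (rule the_equality)
  show "j \<in> insert j (I - {i}) \<and> (\<exists>i'\<in>I. I - {i'} = insert j (I - {i}) - {j})"
    using assms by auto
  show "k = j" if "k \<in> insert j (I - {i}) \<and> (\<exists>i'\<in>I. I - {i'} = insert j (I - {i}) - {k})" for k
    using that assms by blast
qed

text \<open>With the word as a parameter, every result can also be instantiated at a prefix of
  \<open>Q\<close>.\<close>

locale subword_complex = finite_coxeter_realization +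
  fixes Q :: "'a list"
  assumes word: "Q \<in> lists S"
begin

abbreviation "m \<equiv> length Q"
abbreviation "q k \<equiv> Q ! (k - 1)"
abbreviation "P \<equiv> subword_prod W Q"
abbreviation "exch \<equiv> exchangeable W Q"
abbreviation "is_red X \<equiv> len (P X) = length (subword Q X)"

section \<open>Products over sets of positions, reducedness, and flips\<close>

lemma subword_in_lists [simp]: "subword Q X \<in> lists S"
  using word set_nths_subset[of Q] by (auto simp: subword_def in_lists_conv_set)

lemma P_closed [simp]: "P X \<in> carrier W"
  by (simp add: subword_prod_def)

lemma letter_in: "1 \<le> k \<Longrightarrow> k \<le> m \<Longrightarrow> q k \<in> S"
  using word by (auto simp: in_lists_conv_set)

lemma letter_closed [simp]: "1 \<le> k \<Longrightarrow> k \<le> m \<Longrightarrow> q k \<in> carrier W"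
  using letter_in generator_closed by blast

lemma P_split: "P X = P (X \<inter> {..k}) \<otimes> P (X \<inter> {k<..})"
  using subword_split[of Q X k] by (simp add: subword_prod_def)

lemma P_empty [simp]: "P {} = \<one>"
  by (simp add: subword_prod_def subword_def)

lemma P_singleton: "1 \<le> k \<Longrightarrow> k \<le> m \<Longrightarrow> P {k} = q k"
  by (simp add: subword_prod_def subword_singleton generator_closed letter_in)

lemma len_P_le: "len (P X) \<le> card (X \<inter> {1..m})"
  using len_word_prod_le[of "subword Q X"] by (simp add: subword_prod_def length_subword)

lemma P_Un:
  assumes "\<And>a b. a \<in> A \<Longrightarrow> b \<in> B \<Longrightarrow> a < b" "finite A"
  shows "P (A \<union> B) = P A \<otimes> P B"
proof (cases "A = {}")
  case False
  have "(A \<union> B) \<inter> {..Max A} = A" "(A \<union> B) \<inter> {Max A<..} = B"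
    using assms(1)[OF Max_in[OF assms(2) False]] Max_ge[OF assms(2)]
    by (force, auto simp: not_less[symmetric])
  then show ?thesis using P_split[of "A \<union> B" "Max A"] by simp
qed simp

text \<open>Length is subadditive and bounded by the number of letters, so equality for the union
  forces equality for both parts.\<close>

lemma reduced_Un:
  assumes "\<And>a b. a \<in> A \<Longrightarrow> b \<in> B \<Longrightarrow> a < b" "finite A" "is_red (A \<union> B)"
  shows "is_red A" "is_red B"
proof -
  have "(A \<union> B) \<inter> {1..m} = (A \<inter> {1..m}) \<union> (B \<inter> {1..m})" "A \<inter> B = {}"
    using assms(1) by fastforce+
  then have "length (subword Q (A \<union> B)) = length (subword Q A) + length (subword Q B)"
    unfolding length_subword by (subst card_Un_disjoint[symmetric]) auto
  moreover have "len (P (A \<union> B)) \<le> len (P A) + len (P B)"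
    using len_mult_le P_Un[OF assms(1,2)] by simp
  ultimately show "is_red A" "is_red B"
    using assms(3) len_P_le[of A] len_P_le[of B] by (simp_all add: length_subword)
qed

lemma facets_iff: "I \<in> facets W S Q \<rho> \<longleftrightarrow> I \<subseteq> {1..m} \<and> P ({1..m} - I) = \<rho> \<and> is_red ({1..m} - I)"
  by (auto simp: facets_def reduced_expression_def subword_prod_def)

lemma facet_reduced_interval:
  assumes "I \<in> facets W S Q \<rho>" "n \<le> m" "1 \<le> i"
  shows "is_red ({i..n} - I)"
proof -
  have "{1..m} - I = ({1..n} - I) \<union> ({n<..m} - I)" using assms by auto
  then have "is_red ({1..n} - I)"
    using assms reduced_Un(1)[of "{1..n} - I" "{n<..m} - I"] by (force simp: facets_iff)
  moreover have "{1..n} - I = ({1..<i} - I) \<union> ({i..n} - I)" if "i \<le> n" using that assms by auto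
  ultimately show ?thesis
    using reduced_Un(2)[of "{1..<i} - I" "{i..n} - I"]
    using len_P_le[of "{}"] by (cases "i \<le> n") (force, simp add: subword_def)
qed

lemma facet_reduced_interval':
  assumes "I \<in> facets W S Q \<rho>" "n \<le> m"
  shows "is_red ({i<..n} - I)"
  using facet_reduced_interval[OF assms, of "Suc i"] by (simp add: atLeastSucAtMost_greaterThanAtMost)

text \<open>The positions \<open>i\<close> and \<open>j\<close> enter as intersections with
  \<open>X\<close>, so the same factorization serves before and after an exchange.\<close>

lemma P_split_pair:
  assumes "i < j" "X \<subseteq> {1..m}"
  shows "P X = P (X \<inter> {..<i}) \<otimes> (P (X \<inter> {i}) \<otimes> (P (X \<inter> {i<..<j}) \<otimes> (P (X \<inter> {j}) \<otimes> P (X \<inter> {j<..}))))"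
proof -
  have "X = (X \<inter> {..<i}) \<union> ((X \<inter> {i}) \<union> ((X \<inter> {i<..<j}) \<union> ((X \<inter> {j}) \<union> (X \<inter> {j<..}))))"
    using assms(1) by auto
  moreover have "finite X" using assms(2) finite_subset by blast
  ultimately have "P X = P ((X \<inter> {..<i}) \<union>
      ((X \<inter> {i}) \<union> ((X \<inter> {i<..<j}) \<union> ((X \<inter> {j}) \<union> (X \<inter> {j<..})))))" "finite X"
    by simp_all
  then show ?thesis
    using assms(1) by (simp only:) ((subst P_Un, force, force)+, rule refl)
qed

text \<open>Before \<open>i\<close> and after \<open>j\<close> the two products have the same
  factors; cancelling these leaves the commutation equation.\<close>

lemma exchange_prod_iff:
  assumes "i < j" "X \<subseteq> {1..m}" "1 \<le> i" "j \<in> X" "i \<notin> X"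
  shows "P (insert i (X - {j})) = P X \<longleftrightarrow>
    q i \<otimes> P (X \<inter> {i<..<j}) = P (X \<inter> {i<..<j}) \<otimes> q j"
proof -
  let ?Y = "insert i (X - {j})"
  have b: "i \<le> m" "1 \<le> j" "j \<le> m" using assms by auto
  have Y: "?Y \<inter> {..<i} = X \<inter> {..<i}" "?Y \<inter> {i} = {i}" "?Y \<inter> {i<..<j} = X \<inter> {i<..<j}"
    "?Y \<inter> {j} = {}" "?Y \<inter> {j<..} = X \<inter> {j<..}" using assms by auto
  have X: "X \<inter> {i} = {}" "X \<inter> {j} = {j}" using assms by auto
  have "P ?Y = P (X \<inter> {..<i}) \<otimes> ((q i \<otimes> P (X \<inter> {i<..<j})) \<otimes> P (X \<inter> {j<..}))"
    using assms b P_split_pair[of i j ?Y] unfolding Y by (auto simp: P_singleton m_assoc)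
  moreover have "P X = P (X \<inter> {..<i}) \<otimes> ((P (X \<inter> {i<..<j}) \<otimes> q j) \<otimes> P (X \<inter> {j<..}))"
    using assms b P_split_pair[of i j X] unfolding X by (simp add: P_singleton m_assoc)
  ultimately show ?thesis using assms(3) b by simp
qed

text \<open>A drop in length yields \<open>j\<close> by the exchange condition; conversely,
  exchangeability lets \<open>q i\<close> cancel the letter at \<open>j\<close>. The left side
  depends on \<open>I\<close> only through a product, which is what makes the criterion stable under
  flips.\<close>

lemma descent_iff:
  assumes "I \<in> facets W S Q \<rho>" "n \<le> m" "i \<in> I" "i \<le> n"
  shows "len (q i \<otimes> P ({i<..n} - I)) < len (P ({i<..n} - I)) \<longleftrightarrow> (\<exists>j\<le>n. exch I i j)"
proof
  let ?X = "{i<..n} - I"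
  have i: "1 \<le> i" "i \<le> m" using assms by (auto simp: facets_iff)
  {
    assume "len (q i \<otimes> P ?X) < len (P ?X)"
    then obtain us t vs where e: "subword Q ?X = us @ t # vs"
      "q i \<otimes> word_prod W us = word_prod W us \<otimes> t"
      using exchange_condition[of "subword Q ?X" "q i"] letter_in[OF i]
      by (auto simp: subword_prod_def)
    then obtain j where j: "j \<in> ?X \<inter> {1..m}" "us = subword Q (?X \<inter> {..<j})" "t = q j"
      using subword_eq_appendD[OF e(1)] by blast
    moreover have "?X \<inter> {..<j} = {i<..<j} - I" using j(1) by auto
    ultimately show "\<exists>j\<le>n. exch I i j"
      using e(2) assms i unfolding exchangeable_def subword_prod_def
      by (intro exI[of _ j]) auto
  }
  assume "\<exists>j\<le>n. exch I i j"
  then obtain j where j: "j \<le> n" "j \<notin> I" "i < j"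
    "q i \<otimes> P ({i<..<j} - I) = P ({i<..<j} - I) \<otimes> q j"
    unfolding exchangeable_def by blast
  have jm: "1 \<le> j" "j \<le> m" using j i assms(2) by auto
  have sub: "?X \<subseteq> {1..m}" using assms(2) by auto
  have X: "?X \<inter> {..<i} = {}" "?X \<inter> {i} = {}" "?X \<inter> {i<..<j} = {i<..<j} - I" "?X \<inter> {j} = {j}"
    using j by auto
  let ?Y = "?X - {j}"
  have Y: "?Y \<inter> {..<i} = {}" "?Y \<inter> {i} = {}" "?Y \<inter> {i<..<j} = {i<..<j} - I" "?Y \<inter> {j} = {}"
    "?Y \<inter> {j<..} = ?X \<inter> {j<..}"
    using j by auto
  \<comment> \<open>\<open>q i\<close> passes the block between \<open>i\<close> and
    \<open>j\<close>, becomes \<open>q j\<close>, and cancels the letter at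
    \<open>j\<close>.\<close>
  have "q i \<otimes> P ?X = (q i \<otimes> P ({i<..<j} - I)) \<otimes> (q j \<otimes> P (?X \<inter> {j<..}))"
    using P_split_pair[OF j(3) sub] i jm unfolding X by (simp add: P_singleton m_assoc)
  also have "\<dots> = P ({i<..<j} - I) \<otimes> P (?X \<inter> {j<..})"
    unfolding j(4) using jm by (simp add: m_assoc generator_cancel letter_in)
  also have "\<dots> = P ?Y"
    using P_split_pair[OF j(3) subset_trans[OF Diff_subset sub], of "{j}"] unfolding Y by simp
  finally have "len (q i \<otimes> P ?X) \<le> card (?Y \<inter> {1..m})" using len_P_le by simp
  also have "?Y \<inter> {1..m} = (?X \<inter> {1..m}) - {j}" by blast
  also have "card \<dots> < card (?X \<inter> {1..m})"
    by (rule card_Diff1_less) (use j jm in simp_all)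
  finally show "len (q i \<otimes> P ?X) < len (P ?X)"
    using facet_reduced_interval'[OF assms(1,2)] by (simp add: length_subword)
qed

text \<open>The complement keeps both its product and its number of letters, hence stays
  reduced.\<close>

lemma exchange_facet:
  assumes "I \<in> facets W S Q \<rho>" "exch I i j"
  shows "insert j (I - {i}) \<in> facets W S Q \<rho>"
proof -
  let ?C = "{1..m} - I" and ?J = "insert j (I - {i})"
  have ij: "i < j" "i \<in> I" "j \<notin> I" "1 \<le> i" "j \<le> m" using assms(2) by (auto simp: exchangeable_def)
  have C: "{1..m} - ?J = insert i (?C - {j})" using ij by auto
  have "?C \<inter> {i<..<j} = {i<..<j} - I" using ij by auto
  then have "P ({1..m} - ?J) = P ?C"
    unfolding C using exchange_prod_iff[of i j ?C] ij assms(2) by (auto simp: exchangeable_def)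
  moreover have "card ({1..m} - ?J) = card ?C"
    unfolding C using ij card.remove[of ?C j] by simp
  ultimately show ?thesis
    using assms(1) ij by (auto simp: facets_iff length_subword Int_absorb2)
qed

lemma increasing_flip_iff:
  assumes "I \<in> facets W S Q \<rho>"
  shows "increasing_flip W S Q \<rho> I J \<longleftrightarrow> (\<exists>i j. exch I i j \<and> J = insert j (I - {i}))"
proof
  assume "increasing_flip W S Q \<rho> I J"
  then obtain i j where J: "J \<in> facets W S Q \<rho>" "i \<in> I" "j \<in> J" "I - {i} = J - {j}" "i < j"
    unfolding increasing_flip_def by blast
  then have eq: "J = insert j (I - {i})" by (simp add: insert_absorb)
  have "j \<notin> I" using J(4,5) by auto
  have b: "1 \<le> i" "j \<le> m" using J assms by (auto simp: facets_iff)
  have C: "{1..m} - J = insert i (({1..m} - I) - {j})" using eq b J(2,5) by auto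
  have "({1..m} - I) \<inter> {i<..<j} = {i<..<j} - I" using b by auto
  then have "exch I i j"
    using J assms b \<open>j \<notin> I\<close> exchange_prod_iff[of i j "{1..m} - I"]
    unfolding facets_iff C by (auto simp: exchangeable_def)
  then show "\<exists>i j. exch I i j \<and> J = insert j (I - {i})" using eq by blast
next
  assume "\<exists>i j. exch I i j \<and> J = insert j (I - {i})"
  then obtain i j where e: "exch I i j" "J = insert j (I - {i})" by blast
  then have "i < j" "i \<in> I" "j \<notin> I" by (auto simp: exchangeable_def)
  then have "I \<noteq> J" "j \<in> J" "I - {i} = J - {j}" using e(2) by auto
  then show "increasing_flip W S Q \<rho> I J"
    using exchange_facet[OF assms e(1)] assms e(2) \<open>i < j\<close> \<open>i \<in> I\<close>
    unfolding increasing_flip_def by blast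
qed

section \<open>Sinks and rising paths\<close>

lemma exchangeable_bounds:
  "exch I i j \<Longrightarrow> 1 \<le> i \<and> i \<in> I \<and> i < j \<and> j \<notin> I \<and> j \<le> m"
  by (auto simp: exchangeable_def)

lemma exchangeable_transfer:
  assumes "exch I i j" "i \<in> J" "j \<notin> J" "{i<..<j} - I = {i<..<j} - J"
  shows "exch J i j"
  using assms by (simp add: exchangeable_def)

lemma descent_of_first_letter:
  assumes "I \<in> facets W S Q \<rho>" "1 \<le> i" "i \<le> m" "i \<notin> I"
  shows "len (q i \<otimes> P ({i..m} - I)) < len (P ({i..m} - I))"
proof -
  have "{i..m} - I = {i} \<union> ({i<..m} - I)" using assms by auto
  then have "P ({i..m} - I) = q i \<otimes> P ({i<..m} - I)"
    using P_Un[of "{i}" "{i<..m} - I"] assms by (simp add: P_singleton)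
  then have "q i \<otimes> P ({i..m} - I) = P ({i<..m} - I)"
    using assms by (simp add: generator_cancel letter_in)
  then have "len (q i \<otimes> P ({i..m} - I)) \<le> card (({i<..m} - I) \<inter> {1..m})"
    using len_P_le by simp
  also have "({i<..m} - I) \<inter> {1..m} = ({i..m} - I) \<inter> {1..m} - {i}" by auto
  also have "card \<dots> < card (({i..m} - I) \<inter> {1..m})"
    by (rule card_Diff1_less) (use assms in simp_all)
  also have "\<dots> = len (P ({i..m} - I))"
    using facet_reduced_interval[OF assms(1) order_refl assms(2)] by (simp add: length_subword)
  finally show ?thesis .
qed

text \<open>Cancelling the common part before \<open>i\<close> makes the products from
  \<open>i\<close> onwards agree. The word of \<open>J\<close> starts there with \<open>q i\<close>,
  so \<open>q i\<close> is a left descent of the product for \<open>I\<close> too, and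
  \<open>descent_iff\<close> applies.\<close>

lemma exchangeable_of_lex_smaller:
  assumes I: "I \<in> facets W S Q \<rho>" and J: "J \<in> facets W S Q \<rho>"
    and i: "i \<in> I" "i \<notin> J" and agree: "\<And>k. k < i \<Longrightarrow> k \<in> I \<longleftrightarrow> k \<in> J"
  shows "\<exists>j. exch I i j"
proof -
  have b: "1 \<le> i" "i \<le> m" using I i by (auto simp: facets_iff)
  have split: "{1..m} - K = ({1..<i} - K) \<union> ({i..m} - K)" for K using b by auto
  have "P ({1..m} - I) = P ({1..m} - J)" using I J by (simp add: facets_iff)
  moreover have "P ({1..m} - K) = P ({1..<i} - K) \<otimes> P ({i..m} - K)" for K
    unfolding split[of K] by (rule P_Un) auto
  moreover have "{1..<i} - I = {1..<i} - J" using agree by auto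
  ultimately have "P ({i..m} - I) = P ({i..m} - J)" by simp
  moreover have "{i..m} - I = {i<..m} - I" using i by (auto simp: order_le_less)
  ultimately have "len (q i \<otimes> P ({i<..m} - I)) < len (P ({i<..m} - I))"
    using descent_of_first_letter[OF J b i(2)] by simp
  then show ?thesis using descent_iff[OF I order_refl i(1) b(2)] by blast
qed

text \<open>At the first position where two facets differ, the one containing it admits an
  increasing flip.\<close>

lemma sink_unique:
  assumes I: "I \<in> facets W S Q \<rho>" "\<nexists>i j. exch I i j"
    and J: "J \<in> facets W S Q \<rho>" "\<nexists>i j. exch J i j"
  shows "I = J"
proof (rule ccontr)
  assume "I \<noteq> J"
  define i where "i = (LEAST k. (k \<in> I) \<noteq> (k \<in> J))"
  have "\<exists>k. (k \<in> I) \<noteq> (k \<in> J)" using \<open>I \<noteq> J\<close> by blast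
  then have "(i \<in> I) \<noteq> (i \<in> J)" unfolding i_def by (rule LeastI_ex)
  moreover have "k \<in> I \<longleftrightarrow> k \<in> J" if "k < i" for k
    using not_less_Least[of k] that unfolding i_def by blast
  ultimately show False
    using exchangeable_of_lex_smaller[OF I(1) J(1)] exchangeable_of_lex_smaller[OF J(1) I(1)] I J
    by blast
qed

lemma sink_iff:
  assumes "I \<in> facets W S Q \<rho>"
  shows "(\<nexists>J. increasing_flip W S Q \<rho> I J) \<longleftrightarrow> (\<nexists>i j. exch I i j)"
  using increasing_flip_iff[OF assms] by blast

text \<open>An increasing flip raises the sum of the positions, so a facet with maximal sum is a
  sink.\<close>

lemma ex_sink:
  assumes "I \<in> facets W S Q \<rho>"
  obtains N where "N \<in> facets W S Q \<rho>" "\<nexists>i j. exch N i j"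
proof -
  let ?F = "facets W S Q \<rho>"
  let ?M = "Max ((\<lambda>J. \<Sum>J) ` ?F)"
  have "?F \<subseteq> Pow {1..m}" using facets_iff by blast
  then have fin: "finite ?F" by (rule finite_subset) simp
  then have "?M \<in> (\<lambda>J. \<Sum>J) ` ?F" using assms by (intro Max_in) auto
  then obtain N where N: "N \<in> ?F" "?M = \<Sum>N" by blast
  then have max: "\<Sum>J \<le> \<Sum>N" if "J \<in> ?F" for J
    using Max_ge[of "(\<lambda>J. \<Sum>J) ` ?F"] fin that by fastforce
  have "\<not> exch N i j" for i j
  proof
    assume e: "exch N i j"
    have fin: "finite N" using N(1) finite_subset by (auto simp: facets_iff)
    have b: "i \<in> N" "i < j" "j \<notin> N" using exchangeable_bounds[OF e] by auto
    have "\<Sum>(insert j (N - {i})) = j + \<Sum>(N - {i})" using fin b by simp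
    moreover have "\<Sum>N = i + \<Sum>(N - {i})" using fin b by (simp add: sum.remove)
    ultimately show False using max[OF exchange_facet[OF N(1) e]] b by simp
  qed
  then show ?thesis using N(1) that by blast
qed

lemma neg_greedy_iff:
  assumes I: "I \<in> facets W S Q \<rho>"
  shows "I = neg_greedy W S Q \<rho> \<longleftrightarrow> (\<nexists>i j. exch I i j)"
proof -
  obtain N where N: "N \<in> facets W S Q \<rho>" "\<nexists>i j. exch N i j" using ex_sink[OF I] .
  have "neg_greedy W S Q \<rho> = N"
    unfolding neg_greedy_def
  proof (rule the_equality)
    show "N \<in> facets W S Q \<rho> \<and> (\<nexists>J. increasing_flip W S Q \<rho> N J)" using N sink_iff by blast
    show "J = N" if "J \<in> facets W S Q \<rho> \<and> (\<nexists>K. increasing_flip W S Q \<rho> J K)" for J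
      using that N sink_iff sink_unique by blast
  qed
  then show ?thesis using sink_unique[OF I _ N] N by blast
qed

section \<open>Prefixes of the word, and how one flip affects the others\<close>

lemma subword_complex_take: "subword_complex W S act \<alpha> (take k Q)"
  using word by unfold_locales (auto simp: in_lists_conv_set dest: in_set_takeD)

lemma exchangeable_take_iff:
  assumes "I \<subseteq> {1..m}" "k \<le> m"
  shows "exchangeable W (take k Q) (I \<inter> {1..k}) i j \<longleftrightarrow> exch I i j \<and> j \<le> k"
proof (cases "1 \<le> i \<and> i < j \<and> j \<le> k")
  case True
  have "subword_prod W (take k Q) ({i<..<j} - I \<inter> {1..k}) = P ({i<..<j} - I)"
    unfolding subword_prod_def subword_take
    by (rule arg_cong[of _ _ "word_prod W"], rule subword_cong) (use True in auto)
  moreover have "take k Q ! (i - 1) = q i" "take k Q ! (j - 1) = q j"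
    using True by (auto simp: nth_take)
  ultimately show ?thesis using True assms by (auto simp: exchangeable_def)
next
  case False
  then show ?thesis using assms by (auto simp: exchangeable_def)
qed

text \<open>The trace of \<open>I\<close> on a prefix is a facet for the product it leaves there, so
  \<open>neg_greedy_iff\<close> applies to the prefix. This translates the condition defining
  \<open>y\<close>.\<close>

lemma prefix_greedy_iff:
  assumes I: "I \<in> facets W S Q \<rho>" and k: "k \<le> m"
  shows "I \<inter> {1..k} = neg_greedy W S (take k Q) (P ({1..k} - I)) \<longleftrightarrow>
    (\<nexists>i j. exch I i j \<and> j \<le> k)"
proof -
  interpret prefix: subword_complex W S act \<alpha> "take k Q" by (rule subword_complex_take)
  have sub: "I \<subseteq> {1..m}" using I by (simp add: facets_iff)
  have len_k: "length (take k Q) = k" using k by simp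
  have eq: "subword (take k Q) ({1..k} - I \<inter> {1..k}) = subword Q ({1..k} - I)"
    unfolding subword_take by (rule subword_cong) auto
  have "I \<inter> {1..k} \<in> facets W S (take k Q) (P ({1..k} - I))"
    unfolding prefix.facets_iff len_k subword_prod_def eq
    using facet_reduced_interval[OF I k order_refl] by (simp add: subword_prod_def)
  from prefix.neg_greedy_iff[OF this] show ?thesis
    unfolding exchangeable_take_iff[OF sub k] by blast
qed

lemma flip_transfers_sink_back:
  assumes I: "I \<in> facets W S Q \<rho>" and e: "exch I i j"
    and sink: "\<nexists>k l. exch (insert j (I - {i})) k l \<and> l \<le> j"
    and e': "exch I i' j'"
  shows "j < j' \<or> j' = j \<and> i \<le> i'"
proof (rule ccontr)
  let ?J = "insert j (I - {i})"
  assume "\<not> ?thesis"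
  then have less: "j' < j \<or> j' = j \<and> i' < i" by auto
  have J: "?J \<in> facets W S Q \<rho>" by (rule exchange_facet[OF I e])
  note b = exchangeable_bounds[OF e] and b' = exchangeable_bounds[OF e']
  consider "i' < i" | "i' = i" | "i' > i" by linarith
  then show False
  proof cases
    \<comment> \<open>The exchange of \<open>i\<close> and \<open>j\<close> preserves the product
      over the positions after \<open>i'\<close> up to \<open>j\<close>, so the descent at
      \<open>i'\<close> survives in \<open>?J\<close>.\<close>
    case 1
    let ?X = "{i'<..j} - I"
    have X: "?X \<subseteq> {1..m}" "i \<notin> ?X" "j \<in> ?X" "?X \<inter> {i<..<j} = {i<..<j} - I"
      "{i'<..j} - ?J = insert i (?X - {j})" using 1 b by auto
    then have "P ({i'<..j} - ?J) = P ?X"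
      using exchange_prod_iff[of i j ?X] b e by (simp add: exchangeable_def)
    moreover have "len (q i' \<otimes> P ?X) < len (P ?X)"
      using descent_iff[OF I, of j i'] e' b b' less by fastforce
    ultimately have "\<exists>l\<le>j. exch ?J i' l"
      using descent_iff[OF J, of j i'] 1 b b' by auto
    then show False using sink by blast
  next
    case 2
    \<comment> \<open>Here \<open>j' < j\<close>, so \<open>q i\<close> would be a descent of
      \<open>?w\<close>; yet \<open>q i \<otimes> ?w\<close> equals \<open>?w \<otimes> q j\<close>,
      whose word is reduced. The closed upper end \<open>j - 1\<close> matches the form of
      \<open>descent_iff\<close>.\<close>
    let ?w = "P ({i<..j - 1} - I)"
    have open_eq: "{i<..j - 1} - I = {i<..<j} - I" using b by auto
    have "len (q i \<otimes> ?w) < len ?w"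
      using descent_iff[OF I, of "j - 1" i] e' 2 b b' less by fastforce
    moreover have "{i<..j} - I = ({i<..<j} - I) \<union> {j}" using b by auto
    then have "P ({i<..j} - I) = ?w \<otimes> q j"
      using P_Un[of "{i<..<j} - I" "{j}"] b open_eq by (simp add: P_singleton)
    then have "q i \<otimes> ?w = P ({i<..j} - I)" using e open_eq by (simp add: exchangeable_def)
    moreover have "len (P ({i<..j} - I)) = card ({i<..j} - I)" "len ?w = card ({i<..j - 1} - I)"
      using facet_reduced_interval'[OF I, of j i] facet_reduced_interval'[OF I, of "j - 1" i] b
      by (auto simp: length_subword Int_absorb2 subset_iff)
    moreover have "card ({i<..j - 1} - I) \<le> card ({i<..j} - I)" by (rule card_mono) auto
    ultimately show False by simp
  next
    case 3
    \<comment> \<open>Now \<open>j' < j\<close>, and the facets agree strictly between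
      \<open>i\<close> and \<open>j\<close>.\<close>
    then have "exch ?J i' j'"
      using less b b' by (intro exchangeable_transfer[OF e']) auto
    moreover have "j' \<le> j" using less by auto
    ultimately show False using sink by blast
  qed
qed

lemma flip_preserves_sink:
  assumes I: "I \<in> facets W S Q \<rho>" and e: "exch I i j"
    and least: "\<And>k l. exch I k l \<Longrightarrow> j < l \<or> l = j \<and> i \<le> k"
    and e': "exch (insert j (I - {i})) i' j'"
  shows "j < j'"
proof (rule ccontr)
  let ?J = "insert j (I - {i})"
  assume "\<not> j < j'"
  have J: "?J \<in> facets W S Q \<rho>" by (rule exchange_facet[OF I e])
  note b = exchangeable_bounds[OF e] and b' = exchangeable_bounds[OF e']
  \<comment> \<open>Equality is impossible because \<open>j\<close> lies in \<open>?J\<close> and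
    \<open>j'\<close> does not.\<close>
  have "j' < j" using b' \<open>\<not> j < j'\<close> by (cases "j' = j") auto
  then have i': "i' \<in> I" "i' \<noteq> i" using b' by auto
  then consider "i' < i" | "i' > i" by linarith
  then show False
  proof cases
    \<comment> \<open>The descent pulled back to \<open>I\<close> may end at \<open>j\<close>
      itself; comparing starting positions among flips with equal end then gives the
      contradiction.\<close>
    case 1
    let ?X = "{i'<..j} - I"
    have X: "?X \<subseteq> {1..m}" "i \<notin> ?X" "j \<in> ?X" "?X \<inter> {i<..<j} = {i<..<j} - I"
      "{i'<..j} - ?J = insert i (?X - {j})" using 1 b by auto
    then have "P ({i'<..j} - ?J) = P ?X"
      using exchange_prod_iff[of i j ?X] b e by (simp add: exchangeable_def)
    moreover have "len (q i' \<otimes> P ({i'<..j} - ?J)) < len (P ({i'<..j} - ?J))"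
      using descent_iff[OF J, of j i'] e' b b' \<open>j' < j\<close> by fastforce
    ultimately have "\<exists>l\<le>j. exch I i' l"
      using descent_iff[OF I, of j i'] 1 b i' by auto
    then show False using least 1 by fastforce
  next
    case 2
    then have "exch I i' j'"
      using i' b b' \<open>j' < j\<close> by (intro exchangeable_transfer[OF e']) auto
    then show False using least \<open>j' < j\<close> by fastforce
  qed
qed

section \<open>First flips and rising paths\<close>

lemma n_rising_path_Cons_iff:
  "n_rising_path W S Q \<rho> (I # J # p) \<longleftrightarrow>
    I \<in> facets W S Q \<rho> \<and> increasing_flip W S Q \<rho> I J \<and> n_rising_path W S Q \<rho> (J # p) \<and>
    (case p of [] \<Rightarrow> True | K # _ \<Rightarrow> n_label I J < n_label J K)"
proof -
  have "sorted_wrt (<) (map2 n_label (I # J # p) (J # p)) \<longleftrightarrow>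
    sorted_wrt (<) (map2 n_label (J # p) p) \<and>
    (case p of [] \<Rightarrow> True | K # _ \<Rightarrow> n_label I J < n_label J K)"
    by (cases p) (auto simp: less_trans)
  then show ?thesis by (auto simp: n_rising_path_def)
qed

definition first_flip :: "nat set \<Rightarrow> nat \<Rightarrow> nat \<Rightarrow> bool" where
  "first_flip I i j \<longleftrightarrow> exch I i j \<and> (\<forall>k l. exch I k l \<longrightarrow> j < l \<or> l = j \<and> i \<le> k)"

lemma first_flip_unique: "first_flip I i j \<Longrightarrow> first_flip I i' j' \<Longrightarrow> i = i' \<and> j = j'"
  unfolding first_flip_def by (metis less_asym order_antisym less_irrefl)

lemma ex_first_flip:
  assumes "exch I k l"
  obtains i j where "first_flip I i j"
proof -
  define j where "j = (LEAST j. \<exists>i. exch I i j)"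
  define i where "i = (LEAST i. exch I i j)"
  have "\<exists>i. exch I i j" unfolding j_def by (rule LeastI2_wellorder_ex) (use assms in blast)+
  then have "exch I i j" unfolding i_def by (rule LeastI_ex)
  moreover have "j < l \<or> l = j \<and> i \<le> k" if "exch I k l" for k l
  proof -
    have "j \<le> l" unfolding j_def by (rule Least_le) (use that in blast)
    moreover have "i \<le> k" if "l = j" unfolding i_def by (rule Least_le) (use \<open>exch I k l\<close> that in blast)
    ultimately show ?thesis by auto
  qed
  ultimately show ?thesis using that unfolding first_flip_def by blast
qed

lemma n_label_exchange: "exch I i j \<Longrightarrow> n_label I (insert j (I - {i})) = j"
  using n_label_flip exchangeable_bounds by (metis less_irrefl)

text \<open>Induction from the sink backwards, with \<open>flip_transfers_sink_back\<close> at each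
  step.\<close>

lemma rising_path_starts_with_first_flip:
  assumes "n_rising_path W S Q \<rho> (I # J # p)" "last (I # J # p) = neg_greedy W S Q \<rho>"
  shows "\<exists>i j. first_flip I i j \<and> J = insert j (I - {i})"
  using assms
proof (induction p arbitrary: I J)
  case Nil
  then have I: "I \<in> facets W S Q \<rho>" and flip: "increasing_flip W S Q \<rho> I J"
    by (auto simp: n_rising_path_Cons_iff)
  then have "J \<in> facets W S Q \<rho>" by (simp add: increasing_flip_def)
  then have sink: "\<nexists>i j. exch J i j" using Nil.prems(2) neg_greedy_iff by auto
  obtain i j where e: "exch I i j" "J = insert j (I - {i})"
    using increasing_flip_iff[OF I] flip by blast
  have "first_flip I i j"
    unfolding first_flip_def using flip_transfers_sink_back[OF I e(1)] e sink by blast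
  then show ?case using e(2) by blast
next
  case (Cons K p)
  then have I: "I \<in> facets W S Q \<rho>" and flip: "increasing_flip W S Q \<rho> I J"
    and less: "n_label I J < n_label J K" and path: "n_rising_path W S Q \<rho> (J # K # p)"
    by (auto simp: n_rising_path_Cons_iff[of _ I])
  obtain i j where e: "exch I i j" "J = insert j (I - {i})"
    using increasing_flip_iff[OF I] flip by blast
  obtain k l where kl: "first_flip J k l" "K = insert l (J - {k})"
    using Cons.IH[OF path] Cons.prems(2) by auto
  have "j < l"
    using less n_label_exchange[OF e(1)] n_label_exchange[of J k l] kl e(2)
    by (simp add: first_flip_def)
  \<comment> \<open>By induction \<open>l\<close> is the smallest end of a flip of \<open>J\<close>,
    so the rising label excludes all flips of \<open>J\<close> inside the first \<open>j\<close>
    positions.\<close>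
  then have "\<nexists>k l. exch J k l \<and> l \<le> j"
    using kl(1) unfolding first_flip_def by fastforce
  then have "first_flip I i j"
    unfolding first_flip_def using flip_transfers_sink_back[OF I e(1)] e by blast
  then show ?case using e(2) by blast
qed

text \<open>The path always takes the first flip. The bound \<open>n\<close> stands for the
  preceding label, and \<open>m - n\<close> decreases along the path.\<close>

lemma ex_rising_path:
  assumes "I \<in> facets W S Q \<rho>" "\<And>i j. exch I i j \<Longrightarrow> n < j"
  shows "\<exists>p. n_rising_path W S Q \<rho> (I # p) \<and> last (I # p) = neg_greedy W S Q \<rho> \<and>
    (case p of [] \<Rightarrow> True | J # _ \<Rightarrow> n < n_label I J)"
  using assms
proof (induction "m - n" arbitrary: I n rule: less_induct)
  case less
  show ?case
  proof (cases "\<exists>i j. exch I i j")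
    case False
    then have "I = neg_greedy W S Q \<rho>" using neg_greedy_iff[OF less.prems(1)] by blast
    then show ?thesis using less.prems(1)
      by (intro exI[of _ "[]"]) (simp add: n_rising_path_def)
  next
    case True
    then obtain i j where f: "first_flip I i j" using ex_first_flip by blast
    then have e: "exch I i j" by (simp add: first_flip_def)
    let ?J = "insert j (I - {i})"
    have "n < j" "j \<le> m" using less.prems(2)[OF e] exchangeable_bounds[OF e] by auto
    have J: "?J \<in> facets W S Q \<rho>" by (rule exchange_facet[OF less.prems(1) e])
    \<comment> \<open>This provides the bound \<open>j\<close> for the rest of the path.\<close>
    have "j < l" if "exch ?J k l" for k l
      using flip_preserves_sink[OF less.prems(1) e _ that] f unfolding first_flip_def by blast
    moreover have "m - j < m - n" using \<open>n < j\<close> \<open>j \<le> m\<close> by linarith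
    ultimately obtain p where p: "n_rising_path W S Q \<rho> (?J # p)"
      "last (?J # p) = neg_greedy W S Q \<rho>" "case p of [] \<Rightarrow> True | K # _ \<Rightarrow> j < n_label ?J K"
      using less.hyps[OF _ J, of j] by blast
    have "increasing_flip W S Q \<rho> I ?J" using increasing_flip_iff[OF less.prems(1)] e by blast
    then have "n_rising_path W S Q \<rho> (I # ?J # p)"
      using p less.prems(1)
      by (cases p) (simp_all add: n_rising_path_Cons_iff[of _ I] n_label_exchange[OF e])
    then show ?thesis using p(2) \<open>n < j\<close>
      by (intro exI[of _ "?J # p"]) (simp add: n_label_exchange[OF e])
  qed
qed

lemma father_eq_first_flip:
  assumes I: "I \<in> facets W S Q \<rho>" and f: "first_flip I i j"
  shows "father W S Q \<rho> I = insert j (I - {i})"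
  unfolding father_def
proof (rule the_equality)
  have start: "J = insert j (I - {i})"
    if "n_rising_path W S Q \<rho> (I # J # p)" "last (I # J # p) = neg_greedy W S Q \<rho>" for J p
    using rising_path_starts_with_first_flip[OF that] first_flip_unique[OF f] by blast
  then show "J = insert j (I - {i})"
    if "\<exists>p. n_rising_path W S Q \<rho> (I # J # p) \<and> last (I # J # p) = neg_greedy W S Q \<rho>" for J
    using that by blast
  have e: "exch I i j" using f by (simp add: first_flip_def)
  \<comment> \<open>The bound \<open>0\<close> imposes no restriction, since positions start at
    1.\<close>
  obtain p where p: "n_rising_path W S Q \<rho> (I # p)" "last (I # p) = neg_greedy W S Q \<rho>"
    using ex_rising_path[OF I, of 0] exchangeable_bounds by fastforce
  have "p \<noteq> []"
  proof
    assume "p = []"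
    then have "I = neg_greedy W S Q \<rho>" using p(2) by simp
    then show False using neg_greedy_iff[OF I] e by blast
  qed
  then obtain J p' where "p = J # p'" by (cases p) auto
  then show "\<exists>p. n_rising_path W S Q \<rho> (I # insert j (I - {i}) # p) \<and>
      last (I # insert j (I - {i}) # p) = neg_greedy W S Q \<rho>"
    using p start by blast
qed

section \<open>Flips and the root function\<close>

lemma root_function_split:
  assumes "i \<in> I" "1 \<le> i" "i < j" "j \<le> m"
  shows "root_function W act \<alpha> Q I j =
    act (P ({1..i - 1} - I)) (act (P ({i<..<j} - I)) (\<alpha> (q j)))"
proof -
  have "{1..j - 1} - I = ({1..i - 1} - I) \<union> ({i<..<j} - I)"
  proof -
    have "{1..j - 1} = {1..<j}" "{1..i - 1} = {1..<i}" using assms by auto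
    then show ?thesis using assms by (auto simp: not_less order_le_less)
  qed
  moreover have "P (({1..i - 1} - I) \<union> ({i<..<j} - I)) = P ({1..i - 1} - I) \<otimes> P ({i<..<j} - I)"
    by (rule P_Un) (use assms in auto)
  ultimately show ?thesis by (simp add: root_function_def act_mult)
qed

text \<open>The common prefix acts injectively, so equality of roots reduces to the block between
  \<open>i\<close> and \<open>j\<close>. The word of \<open>?w \<otimes> q j\<close> is reduced,
  which selects the positive sign in \<open>commute_iff_root\<close>.\<close>

lemma exchangeable_iff_root_function:
  assumes I: "I \<in> facets W S Q \<rho>" and ij: "i \<in> I" "i < j" "j \<notin> I" "j \<le> m"
  shows "exch I i j \<longleftrightarrow> root_function W act \<alpha> Q I i = root_function W act \<alpha> Q I j"
proof -
  let ?w = "P ({i<..<j} - I)" and ?u = "P ({1..i - 1} - I)"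
  have b: "1 \<le> i" "i \<le> m" "1 \<le> j" using I ij by (auto simp: facets_iff)
  have inj: "inj (act ?u)"
    by (rule orthogonal_transformation_inj[OF orthogonal_transformation_act]) simp
  have "root_function W act \<alpha> Q I i = root_function W act \<alpha> Q I j \<longleftrightarrow>
      act ?w (\<alpha> (q j)) = \<alpha> (q i)"
    unfolding root_function_split[OF ij(1) b(1) ij(2,4)]
    using inj by (auto simp: root_function_def inj_eq)
  also have "\<dots> \<longleftrightarrow> q i \<otimes> ?w = ?w \<otimes> q j"
  proof
    show "q i \<otimes> ?w = ?w \<otimes> q j" if "act ?w (\<alpha> (q j)) = \<alpha> (q i)"
      using that commute_iff_root b ij letter_in by simp
    assume comm: "q i \<otimes> ?w = ?w \<otimes> q j"
    have "{i<..j} - I = ({i<..<j} - I) \<union> {j}" using ij by auto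
    then have "P ({i<..j} - I) = ?w \<otimes> q j" "card ({i<..j} - I) = Suc (card ({i<..<j} - I))"
      using P_Un[of "{i<..<j} - I" "{j}"] b ij by (simp_all add: P_singleton)
    moreover have "len (P ({i<..j} - I)) = card ({i<..j} - I)"
      using facet_reduced_interval'[OF I ij(4), of i] ij
      by (simp add: length_subword Int_absorb2 subset_iff)
    moreover have "len ?w \<le> card ({i<..<j} - I)"
      using len_P_le[of "{i<..<j} - I"] ij by (simp add: Int_absorb2 subset_iff)
    ultimately have "len ?w < len (?w \<otimes> q j)" by simp
    then show "act ?w (\<alpha> (q j)) = \<alpha> (q i)"
      using root_eq_of_commute comm b ij letter_in by simp
  qed
  finally show ?thesis using b ij by (auto simp: exchangeable_def)
qed

end

theorem proposition4p19:
  fixes W :: "('w, 'm) monoid_scheme" and S :: "'w set"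
    and act :: "'w \<Rightarrow> 'v \<Rightarrow> 'v::euclidean_space" and \<alpha> :: "'w \<Rightarrow> 'v"
    and Q :: "'w list" and \<rho> :: 'w and I :: "nat set" and x y :: nat
  assumes "finite_coxeter_realization W S act \<alpha>"
    and "Q \<in> lists S"
    and "\<rho> \<in> carrier W"
    and "I \<in> facets W S Q \<rho>"
    and "I \<noteq> neg_greedy W S Q \<rho>"
    and "y = (LEAST k. k \<in> {1..length Q} \<and>
                I \<inter> {1..k} \<noteq> neg_greedy W S (take k Q) (subword_prod W Q ({1..k} - I)))"
    and "x = (LEAST k. k \<in> I \<and> root_function W act \<alpha> Q I k = root_function W act \<alpha> Q I y)"
  shows "is_flip W S Q \<rho> I x (father W S Q \<rho> I)"
proof -
  interpret subword_complex W S act \<alpha> Q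
    using assms(1,2) by (simp add: subword_complex_def subword_complex_axioms_def)
  note I = \<open>I \<in> facets W S Q \<rho>\<close>
  obtain k l where "exch I k l" using neg_greedy_iff[OF I] assms(5) by blast
  then obtain i j where f: "first_flip I i j" using ex_first_flip by blast
  then have e: "exch I i j" and least: "\<And>k l. exch I k l \<Longrightarrow> j < l \<or> l = j \<and> i \<le> k"
    by (auto simp: first_flip_def)
  note b = exchangeable_bounds[OF e]
  \<comment> \<open>By \<open>prefix_greedy_iff\<close> a prefix fails to be greedy exactly when it
    contains the end of some flip, and \<open>j\<close> is the smallest end.\<close>
  have "y = j"
    unfolding assms(6)
  proof (rule Least_equality)
    show "j \<in> {1..m} \<and> I \<inter> {1..j} \<noteq> neg_greedy W S (take j Q) (P ({1..j} - I))"
      using prefix_greedy_iff[OF I, of j] e b by auto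
    show "j \<le> k"
      if "k \<in> {1..m} \<and> I \<inter> {1..k} \<noteq> neg_greedy W S (take k Q) (P ({1..k} - I))" for k
      using that prefix_greedy_iff[OF I, of k] least by fastforce
  qed
  moreover have "x = i"
    unfolding assms(7) \<open>y = j\<close>
  proof (rule Least_equality)
    show "i \<in> I \<and> root_function W act \<alpha> Q I i = root_function W act \<alpha> Q I j"
      using exchangeable_iff_root_function[OF I, of i j] e b by blast
    show "i \<le> k" if "k \<in> I \<and> root_function W act \<alpha> Q I k = root_function W act \<alpha> Q I j" for k
    \<comment> \<open>Positions before \<open>j\<close> with this root are starts of flips ending at
      \<open>j\<close>; those from \<open>j\<close> onwards exceed \<open>i\<close> anyway.\<close>
    proof (cases "k < j")
      case True
      then have "exch I k j" using exchangeable_iff_root_function[OF I, of k j] that b by blast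
      then show ?thesis using least by blast
    qed (use b in linarith)
  qed
  moreover have "I - {i} = insert j (I - {i}) - {j}" "I \<noteq> insert j (I - {i})" using b by auto
  ultimately show ?thesis
    using I exchange_facet[OF I e] b unfolding is_flip_def father_eq_first_flip[OF I f] by blast
qed

end
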